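(* Let $\mathcal A$, $\mathsf U$, $\mathcal M$, $\Omega$ satisfy (A1)–(A3), (S1) and (S0), and let $\underset{\sim}{\mathcal M}=(N;G,R\cup S,\mathcal T)$ be the alter ego specified in the context. Fix $\mathbf A\in\mathcal A$, let $\mathbf X=\mathsf D(\mathbf A)$, and let $(Z;\sqsubseteq,\mathcal T)$ be the quotient structure obtained from $(Y;\preccurlyeq,\mathcal T_Y)$ as described in the context. Define $\Psi:Z\to\mathsf H_u\mathsf U(\mathbf A)$ by $[(x,\omega)]\mapsto\omega\circ x$. (i) $\Psi$ is well defined and establishes an order-homeomorphism (a homeomorphism that is an order-isomorphism) between $Z$ and $\mathsf H_u\mathsf U(\mathbf A)$, regarded as ordered topological spaces. (ii) Take $x_1$ and $\omega_1$ such that $\omega_1\circ x_1=\overline{\mathbf 1}$ and $x_0$ and $\omega_0$ such that $\omega_0\circ x_0=\overline{\mathbf 0}$ (where $(x_1,\omega_1),(x_0,\omega_0)\in Y$). Then the quotient structure $(Z;\sqsubseteq,\mathcal T)$ enriched with $z_1=[(x_1,\omega_1)]$ and $z_0=[(x_0,\omega_0)]$ is a doubly-pointed Priestley space. Moreover, $\Psi$ is then a $\mathcal P_u$-isomorphism.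
   Context: $\mathcal D_u$ is the variety of (unbounded) distributive lattices, in the language $\{\vee,\wedge\}$ with no constants for bounds; $\mathcal D_u=\mathbb{ISP}(\mathbf 2)$ with $\mathbf 2=(\{0,1\};\vee,\wedge)$, $0<1$. Algebras are non-empty. $\mathcal P_u$ is the category of doubly-pointed Priestley spaces: the isomorphic copies of closed substructures of non-empty powers of $\underset{\sim}{\mathbf 2}=(\{0,1\};\leqslant,\boldsymbol 1,\boldsymbol 0,\mathcal T)$, where $0<1$, $\boldsymbol 1,\boldsymbol 0$ are nullary operations with values $1,0$, and $\mathcal T$ is discrete. Morphisms are continuous order-preserving maps preserving the two distinguished points (which are the top and bottom of the order). For $\mathbf B\in\mathcal D_u$, $\mathsf H_u(\mathbf B)=\mathcal D_u(\mathbf B,\mathbf 2)$, the set of all lattice homomorphisms $\mathbf B\to\mathbf 2$ (constant maps included), regarded as a substructure of $\underset{\sim}{\mathbf 2}^{B}$: pointwise order, topology induced from the product topology, distinguished points the constant maps $\overline{\mathbf 1}$ and $\overline{\mathbf 0}$. Framework assumptions. (A1) There is a forgetful functor $\mathsf U:\mathcal A\to\mathcal D_u$ (each algebra in $\mathcal A$ has a reduct in $\mathcal D_u$, on the same universe, and $\mathsf U$ sends an algebra to this reduct and a homomorphism to the same underlying map). (A2) $\mathcal A$ is a finitely generated quasivariety or variety expressed in the form $\mathcal A=\mathbb{ISP}(\mathcal M)$, where $\mathcal M$ is a finite set of pairwise disjoint (formally, disjointified) finite algebras in $\mathcal A$, called sorts. $M$ denotes the universe of $\mathbf M$, and $\mathcal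 A(\mathbf A,\mathbf B)$ the set of homomorphisms from $\mathbf A$ to $\mathbf B$. (A3) To each $\mathbf M\in\mathcal M$ is associated a chosen non-empty set $\Omega_{\mathbf M}\subseteq\mathcal D_u(\mathsf U(\mathbf M),\mathbf 2)$ of carriers, and $\Omega:=\bigcup_{\mathbf M\in\mathcal M}\Omega_{\mathbf M}$. (S1) There exist a sort $\mathbf M_1\in\mathcal M$ having a $1$-element subalgebra $\{d_1\}$ and $\omega\in\Omega_{\mathbf M_1}$ with $\omega(d_1)=1$. (S0) There exist a sort $\mathbf M_0\in\mathcal M$ having a $1$-element subalgebra $\{d_0\}$ and $\omega\in\Omega_{\mathbf M_0}$ with $\omega(d_0)=0$. Alter ego. $\underset{\sim}{\mathcal M}=(N;G,R\cup S,\mathcal T)$, where: $N=\bigsqcup\{M\mid\mathbf M\in\mathcal M\}$; $\mathcal T$ is the union of the discrete topologies on the $M$; $G\subseteq\bigcup\{\mathcal A(\mathbf M,\mathbf M')\mid\mathbf M,\mathbf M'\in\mathcal M\}$ is such that $\mathrm{Sep}_{\mathcal M,G,\Omega}$ holds, i.e. for all $\mathbf M\in\mathcal M$ and $a\ne b$ in $\mathbf M$, either there is $\omega\in\Omega_{\mathbf M}$ with $\omega(a)\ne\omega(b)$, or there are $\mathbf M'\in\mathcal M$, $\omega'\in\Omega_{\mathbf M'}$, $u\in\mathcal A(\mathbf M,\mathbf M')\cap G$ with $\omega'(u(a))\ne\omega'(u(b))$; $R=\bigcup_{\omega,\omega'\in\Omega}R_{\omega,\omega'}$, where for $\omega\in\Omega_{\mathbf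 M}$, $\omega'\in\Omega_{\mathbf M'}$, $R_{\omega,\omega'}$ is the set of universes of those subalgebras of $\mathbf M\times\mathbf M'$ which are contained in $(\omega,\omega')^{-1}(\leqslant)=\{(a,b)\in\mathbf M\times\mathbf M'\mid\omega(a)\leqslant\omega'(b)\}$ and are maximal under inclusion among such subalgebras; and $S$ consists of the sets $\{d_1\}$ and $\{d_0\}$ from (S1) and (S0). Natural dual. For $\mathbf A\in\mathcal A$, $\mathbf X=\mathsf D(\mathbf A)$ is the multisorted structure with sorts $\mathbf X_M=\mathcal A(\mathbf A,\mathbf M)$, each a closed subspace of $M^A$ (product topology, $M$ discrete), with $G$, $R$, $S$ lifted pointwise; in particular, for $r\in R$ with $r\subseteq M\times M'$, $r^{\mathbf X}=\{(x,x')\in\mathbf X_M\times\mathbf X_{M'}\mid(x(a),x'(a))\in r\text{ for all }a\in\mathbf A\}$. The structures $Y$ and $Z$. $Y=\bigcup\{\mathbf X_M\times\Omega_{\mathbf M}\mid\mathbf M\in\mathcal M\}$, with the topology $\mathcal T_Y$ having as a base the sets $U\times\{\omega\}$ with $U$ open in $\mathbf X_M$ and $\omega\in\Omega_{\mathbf M}$, and with the binary relation $(x,\omega)\preccurlyeq(x',\omega')$ iff there exists $r\in R_{\omega,\omega'}$ with $(x,x')\in r^{\mathbf X}$. This relation is a pre-order; $\approx$ denotes the equivalence relation $\preccurlyeq\cap\succcurlyeq$, $[y]$ the $\approx$-class of $y$, $Z:=Y/{\approx}$, $\sqsubseteq$ the quotient partial order ($[y]\sqsubseteq[y']$ iff $y\preccurlyeq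 y'$), and the topology $\mathcal T$ on $Z$ is the quotient topology derived from $\mathcal T_Y$. *)

theory Defs
  imports "HOL-Analysis.Analysis"
begin

section \<open>Algebras over a finitary signature\<close>

text \<open>A signature is an arity function \<open>ar\<close> on a type of operation symbols; nullary operations are
  allowed. Algebras are non-empty and live on a carrier set inside an arbitrary type.\<close>

record ('f, 'a) algebra =
  universe :: "'a set"
  interp :: "'f \<Rightarrow> 'a list \<Rightarrow> 'a"

definition is_algebra :: "('f \<Rightarrow> nat) \<Rightarrow> ('f, 'a) algebra \<Rightarrow> bool" where
  "is_algebra ar A \<longleftrightarrow> universe A \<noteq> {} \<and>
     (\<forall>f xs. length xs = ar f \<and> set xs \<subseteq> universe A \<longrightarrow> interp A f xs \<in> universe A)"

text \<open>Homomorphisms are extensional functions, so that this set is the set of homomorphisms and not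
  a set of representatives with arbitrary values outside the universe.\<close>

definition hom :: "('f \<Rightarrow> nat) \<Rightarrow> ('f, 'a) algebra \<Rightarrow> ('f, 'b) algebra \<Rightarrow> ('a \<Rightarrow> 'b) set" where
  "hom ar A B = {h \<in> universe A \<rightarrow>\<^sub>E universe B.
     \<forall>f xs. length xs = ar f \<and> set xs \<subseteq> universe A \<longrightarrow>
       h (interp A f xs) = interp B f (map h xs)}"

definition isomorphic :: "('f \<Rightarrow> nat) \<Rightarrow> ('f, 'a) algebra \<Rightarrow> ('f, 'b) algebra \<Rightarrow> bool" where
  "isomorphic ar A B \<longleftrightarrow> (\<exists>h \<in> hom ar A B. bij_betw h (universe A) (universe B))"

definition subuniverse :: "('f \<Rightarrow> nat) \<Rightarrow> ('f, 'a) algebra \<Rightarrow> 'a set \<Rightarrow> bool" where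
  "subuniverse ar A S \<longleftrightarrow> S \<subseteq> universe A \<and> S \<noteq> {} \<and>
     (\<forall>f xs. length xs = ar f \<and> set xs \<subseteq> S \<longrightarrow> interp A f xs \<in> S)"

definition subalgebra :: "('f, 'a) algebra \<Rightarrow> 'a set \<Rightarrow> ('f, 'a) algebra" where
  "subalgebra A S = \<lparr>universe = S, interp = interp A\<rparr>"

definition product_algebra ::
    "'i set \<Rightarrow> ('i \<Rightarrow> ('f, 'a) algebra) \<Rightarrow> ('f, 'i \<Rightarrow> 'a) algebra" where
  "product_algebra I F =
     \<lparr>universe = (\<Pi>\<^sub>E i\<in>I. universe (F i)),
      interp = (\<lambda>f xs. \<lambda>i\<in>I. interp (F i) f (map (\<lambda>x. x i) xs))\<rparr>"

definition pair_algebra ::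
    "('f, 'a) algebra \<Rightarrow> ('f, 'b) algebra \<Rightarrow> ('f, 'a \<times> 'b) algebra" where
  "pair_algebra A B =
     \<lparr>universe = universe A \<times> universe B,
      interp = (\<lambda>f xs. (interp A f (map fst xs), interp B f (map snd xs)))\<rparr>"

text \<open>The type of the indices of the products cannot be quantified inside a formula, so it is a
  parameter; a theorem that assumes \<open>in_ISP TYPE('i)\<close> for a type variable \<open>'i\<close> covers all
  products. The empty product is allowed.\<close>

definition in_ISP ::
    "'i itself \<Rightarrow> ('f \<Rightarrow> nat) \<Rightarrow> ('f, 'm) algebra set \<Rightarrow> ('f, 'a) algebra \<Rightarrow> bool" where
  "in_ISP (_ :: 'i itself) ar \<M> A \<longleftrightarrow> is_algebra ar A \<and>
     (\<exists>(I :: 'i set) F S. F \<in> I \<rightarrow> \<M> \<and> subuniverse ar (product_algebra I F) S \<and>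
        isomorphic ar A (subalgebra (product_algebra I F) S))"


section \<open>Distributive lattices without bounds and term reducts\<close>

datatype lat_op = Join | Meet

abbreviation lat_ar :: "lat_op \<Rightarrow> nat" where
  "lat_ar \<equiv> \<lambda>_. 2"

definition distributive_lattice :: "(lat_op, 'a) algebra \<Rightarrow> bool" where
  "distributive_lattice L \<longleftrightarrow> is_algebra lat_ar L \<and>
     (let join = (\<lambda>a b. interp L Join [a, b]); meet = (\<lambda>a b. interp L Meet [a, b])
      in \<forall>a\<in>universe L. \<forall>b\<in>universe L. \<forall>c\<in>universe L.
           join a b = join b a \<and> meet a b = meet b a \<and>
           join (join a b) c = join a (join b c) \<and> meet (meet a b) c = meet a (meet b c) \<and>
           join a (meet a b) = a \<and> meet a (join a b) = a \<and>
           meet a (join b c) = join (meet a b) (meet a c))"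

text \<open>The two-element lattice, with \<^term>\<open>False\<close> and \<^term>\<open>True\<close> for 0 and 1.\<close>

definition two :: "(lat_op, bool) algebra" where
  "two = \<lparr>universe = UNIV,
     interp = (\<lambda>f xs. case f of Join \<Rightarrow> xs ! 0 \<or> xs ! 1 | Meet \<Rightarrow> xs ! 0 \<and> xs ! 1)\<rparr>"

datatype 'f trm = Var nat | App 'f "'f trm list"

primrec eval :: "('f, 'a) algebra \<Rightarrow> (nat \<Rightarrow> 'a) \<Rightarrow> 'f trm \<Rightarrow> 'a" where
  "eval A v (Var n) = v n"
| "eval A v (App f ts) = interp A f (map (eval A v) ts)"

fun term_of_arity :: "('f \<Rightarrow> nat) \<Rightarrow> nat \<Rightarrow> 'f trm \<Rightarrow> bool" where
  "term_of_arity ar k (Var n) \<longleftrightarrow> n < k"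
| "term_of_arity ar k (App f ts) \<longleftrightarrow> length ts = ar f \<and> (\<forall>t\<in>set ts. term_of_arity ar k t)"

text \<open>The forgetful functor is given by binary terms \<open>\<tau> Join\<close> and \<open>\<tau> Meet\<close> in the signature of
  the algebras; a basic binary operation \<open>f\<close> is the term \<open>App f [Var 0, Var 1]\<close>. Homomorphisms
  commute with term operations, so the functor is the identity on underlying maps.\<close>

definition reduct :: "(lat_op \<Rightarrow> 'f trm) \<Rightarrow> ('f, 'a) algebra \<Rightarrow> (lat_op, 'a) algebra" where
  "reduct \<tau> A = \<lparr>universe = universe A, interp = (\<lambda>f xs. eval A (\<lambda>i. xs ! i) (\<tau> f))\<rparr>"


section \<open>Doubly-pointed Priestley spaces\<close>

record 'p ordered_space =
  top_of :: "'p topology"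
  ord_of :: "'p rel"

record 'p pointed_space = "'p ordered_space" +
  pt1 :: 'p
  pt0 :: 'p

definition order_homeomorphism ::
    "('p, 'y) ordered_space_scheme \<Rightarrow> ('q, 'z) ordered_space_scheme \<Rightarrow> ('p \<Rightarrow> 'q) \<Rightarrow> bool" where
  "order_homeomorphism P Q f \<longleftrightarrow> homeomorphic_map (top_of P) (top_of Q) f \<and>
     (\<forall>p \<in> topspace (top_of P). \<forall>p' \<in> topspace (top_of P).
        (p, p') \<in> ord_of P \<longleftrightarrow> (f p, f p') \<in> ord_of Q)"

definition pointed_structure :: "'p pointed_space \<Rightarrow> bool" where
  "pointed_structure P \<longleftrightarrow>
     ord_of P \<subseteq> topspace (top_of P) \<times> topspace (top_of P) \<and>
     pt1 P \<in> topspace (top_of P) \<and> pt0 P \<in> topspace (top_of P)"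

definition pointed_morphism :: "'p pointed_space \<Rightarrow> 'q pointed_space \<Rightarrow> ('p \<Rightarrow> 'q) \<Rightarrow> bool" where
  "pointed_morphism P Q f \<longleftrightarrow> continuous_map (top_of P) (top_of Q) f \<and>
     (\<forall>(p, p') \<in> ord_of P. (f p, f p') \<in> ord_of Q) \<and>
     f (pt1 P) = pt1 Q \<and> f (pt0 P) = pt0 Q"

definition pointed_isomorphism :: "'p pointed_space \<Rightarrow> 'q pointed_space \<Rightarrow> ('p \<Rightarrow> 'q) \<Rightarrow> bool" where
  "pointed_isomorphism P Q f \<longleftrightarrow> pointed_morphism P Q f \<and>
     (\<exists>g. pointed_morphism Q P g \<and>
        (\<forall>p \<in> topspace (top_of P). g (f p) = p) \<and> (\<forall>q \<in> topspace (top_of Q). f (g q) = q))"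

definition two_power :: "'i set \<Rightarrow> ('i \<Rightarrow> bool) pointed_space" where
  "two_power I =
     \<lparr>top_of = product_topology (\<lambda>_. discrete_topology UNIV) I,
      ord_of = {(p, q). p \<in> (\<Pi>\<^sub>E i\<in>I. UNIV) \<and> q \<in> (\<Pi>\<^sub>E i\<in>I. UNIV) \<and> (\<forall>i\<in>I. p i \<le> q i)},
      pt1 = (\<lambda>i\<in>I. True), pt0 = (\<lambda>i\<in>I. False)\<rparr>"

definition pointed_substructure :: "'p pointed_space \<Rightarrow> 'p set \<Rightarrow> 'p pointed_space" where
  "pointed_substructure P S =
     \<lparr>top_of = subtopology (top_of P) S, ord_of = ord_of P \<inter> S \<times> S, pt1 = pt1 P, pt0 = pt0 P\<rparr>"

definition closed_pointed_subset :: "'p pointed_space \<Rightarrow> 'p set \<Rightarrow> bool" where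
  "closed_pointed_subset P S \<longleftrightarrow> closedin (top_of P) S \<and> pt1 P \<in> S \<and> pt0 P \<in> S"

text \<open>As for \<^const>\<open>in_ISP\<close>, the type of the elements of the exponent is a parameter. To be a
  doubly-pointed Priestley space is to satisfy this for some type \<open>'i\<close>, so a conclusion that
  names one is at least as strong.\<close>

definition pointed_priestley :: "'i itself \<Rightarrow> 'p pointed_space \<Rightarrow> bool" where
  "pointed_priestley (_ :: 'i itself) P \<longleftrightarrow> pointed_structure P \<and>
     (\<exists>(I :: 'i set) S f. I \<noteq> {} \<and> closed_pointed_subset (two_power I) S \<and>
        pointed_isomorphism P (pointed_substructure (two_power I) S) f)"

definition pointed_priestley_isomorphism ::
    "'i itself \<Rightarrow> 'p pointed_space \<Rightarrow> 'q pointed_space \<Rightarrow> ('p \<Rightarrow> 'q) \<Rightarrow> bool" where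
  "pointed_priestley_isomorphism T P Q f \<longleftrightarrow>
     pointed_priestley T P \<and> pointed_priestley T Q \<and> pointed_isomorphism P Q f"

definition Hu :: "(lat_op, 'a) algebra \<Rightarrow> ('a \<Rightarrow> bool) pointed_space" where
  "Hu B = pointed_substructure (two_power (universe B)) (hom lat_ar B two)"


section \<open>Sorts, carriers and the alter ego\<close>

text \<open>Carriers and the operations of the alter ego are given as families indexed by the sorts. As
  extensional functions are total, one and the same HOL function can be extensional on two disjoint
  universes, so a carrier or an operation alone need not determine its domain.\<close>

type_synonym ('f, 'm) carriers = "('f, 'm) algebra \<Rightarrow> ('m \<Rightarrow> bool) set"

type_synonym ('f, 'm) operations = "('f, 'm) algebra \<Rightarrow> ('f, 'm) algebra \<Rightarrow> ('m \<Rightarrow> 'm) set"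

definition sorts :: "('f \<Rightarrow> nat) \<Rightarrow> ('f, 'm) algebra set \<Rightarrow> bool" where
  "sorts ar \<M> \<longleftrightarrow> finite \<M> \<and> (\<forall>M\<in>\<M>. is_algebra ar M \<and> finite (universe M)) \<and>
     pairwise (\<lambda>M M'. disjnt (universe M) (universe M')) \<M>"

definition Sep ::
    "('f, 'm) algebra set \<Rightarrow> ('f, 'm) operations \<Rightarrow> ('f, 'm) carriers \<Rightarrow> bool" where
  "Sep \<M> G \<Omega> \<longleftrightarrow> (\<forall>M\<in>\<M>. \<forall>a\<in>universe M. \<forall>b\<in>universe M. a \<noteq> b \<longrightarrow>
     (\<exists>\<omega>\<in>\<Omega> M. \<omega> a \<noteq> \<omega> b) \<or>
     (\<exists>M'\<in>\<M>. \<exists>\<omega>'\<in>\<Omega> M'. \<exists>u\<in>G M M'. \<omega>' (u a) \<noteq> \<omega>' (u b)))"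

definition alter_ego_rels ::
    "('f \<Rightarrow> nat) \<Rightarrow> ('f, 'm) algebra \<Rightarrow> ('f, 'm) algebra \<Rightarrow>
     ('m \<Rightarrow> bool) \<Rightarrow> ('m \<Rightarrow> bool) \<Rightarrow> ('m \<times> 'm) set set" where
  "alter_ego_rels ar M M' \<omega> \<omega>' =
     (let admissible = (\<lambda>r. subuniverse ar (pair_algebra M M') r \<and>
            r \<subseteq> {(a, b) \<in> universe M \<times> universe M'. \<omega> a \<le> \<omega>' b})
      in {r. admissible r \<and> (\<forall>r'. admissible r' \<and> r \<subseteq> r' \<longrightarrow> r' = r)})"


section \<open>The natural dual and its quotient\<close>

definition dual_top :: "('f \<Rightarrow> nat) \<Rightarrow> ('f, 'a) algebra \<Rightarrow> ('f, 'm) algebra \<Rightarrow> ('a \<Rightarrow> 'm) topology" where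
  "dual_top ar A M =
     subtopology (product_topology (\<lambda>_. discrete_topology (universe M)) (universe A)) (hom ar A M)"

definition lift_rel ::
    "('f \<Rightarrow> nat) \<Rightarrow> ('f, 'a) algebra \<Rightarrow> ('f, 'm) algebra \<Rightarrow> ('f, 'm) algebra \<Rightarrow>
     ('m \<times> 'm) set \<Rightarrow> ('a \<Rightarrow> 'm) rel" where
  "lift_rel ar A M M' r =
     {(x, x') \<in> hom ar A M \<times> hom ar A M'. \<forall>a\<in>universe A. (x a, x' a) \<in> r}"

type_synonym ('a, 'm) ypoint = "('a \<Rightarrow> 'm) \<times> ('m \<Rightarrow> bool)"

definition Y_set ::
    "('f \<Rightarrow> nat) \<Rightarrow> ('f, 'm) algebra set \<Rightarrow> ('f, 'm) carriers \<Rightarrow> ('f, 'a) algebra \<Rightarrow>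
     ('a, 'm) ypoint set" where
  "Y_set ar \<M> \<Omega> A = (\<Union>M\<in>\<M>. hom ar A M \<times> \<Omega> M)"

text \<open>The intersection of two generating sets is again a generating set (possibly with \<open>U = {}\<close>), so
  they are a base and not just a subbase.\<close>

definition Y_top ::
    "('f \<Rightarrow> nat) \<Rightarrow> ('f, 'm) algebra set \<Rightarrow> ('f, 'm) carriers \<Rightarrow> ('f, 'a) algebra \<Rightarrow>
     ('a, 'm) ypoint topology" where
  "Y_top ar \<M> \<Omega> A = topology_generated_by
     {U \<times> {\<omega>} | U \<omega>. \<exists>M\<in>\<M>. openin (dual_top ar A M) U \<and> \<omega> \<in> \<Omega> M}"

text \<open>The sort of \<open>(x, \<omega>)\<close> is determined by \<open>x\<close>, because the sorts are disjoint and the universe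
  of \<open>A\<close> is non-empty; so \<open>M\<close> and \<open>M'\<close> below are unique.\<close>

definition Y_preord ::
    "('f \<Rightarrow> nat) \<Rightarrow> ('f, 'm) algebra set \<Rightarrow> ('f, 'm) carriers \<Rightarrow> ('f, 'a) algebra \<Rightarrow>
     ('a, 'm) ypoint rel" where
  "Y_preord ar \<M> \<Omega> A =
     {((x, \<omega>), (x', \<omega>')). \<exists>M\<in>\<M>. \<exists>M'\<in>\<M>. \<omega> \<in> \<Omega> M \<and> \<omega>' \<in> \<Omega> M' \<and>
        (\<exists>r \<in> alter_ego_rels ar M M' \<omega> \<omega>'. (x, x') \<in> lift_rel ar A M M' r)}"

definition Y_equiv ::
    "('f \<Rightarrow> nat) \<Rightarrow> ('f, 'm) algebra set \<Rightarrow> ('f, 'm) carriers \<Rightarrow> ('f, 'a) algebra \<Rightarrow>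
     ('a, 'm) ypoint rel" where
  "Y_equiv ar \<M> \<Omega> A = Y_preord ar \<M> \<Omega> A \<inter> (Y_preord ar \<M> \<Omega> A)\<inverse>"

abbreviation Y_class ::
    "('f \<Rightarrow> nat) \<Rightarrow> ('f, 'm) algebra set \<Rightarrow> ('f, 'm) carriers \<Rightarrow> ('f, 'a) algebra \<Rightarrow>
     ('a, 'm) ypoint \<Rightarrow> ('a, 'm) ypoint set" where
  "Y_class ar \<M> \<Omega> A y \<equiv> Y_equiv ar \<M> \<Omega> A `` {y}"

definition quotient_topology :: "'p topology \<Rightarrow> 'p rel \<Rightarrow> 'p set topology" where
  "quotient_topology T E =
     topology (\<lambda>W. W \<subseteq> topspace T // E \<and> openin T {p \<in> topspace T. E `` {p} \<in> W})"

lemma openin_quotient_topology: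
  "openin (quotient_topology T E) W \<longleftrightarrow>
     W \<subseteq> topspace T // E \<and> openin T {p \<in> topspace T. E `` {p} \<in> W}"
proof -
  have "istopology (\<lambda>W. W \<subseteq> topspace T // E \<and> openin T {p \<in> topspace T. E `` {p} \<in> W})"
    unfolding istopology_def
  proof (intro conjI allI impI)
    fix S W
    assume S: "S \<subseteq> topspace T // E \<and> openin T {p \<in> topspace T. E `` {p} \<in> S}"
      and W: "W \<subseteq> topspace T // E \<and> openin T {p \<in> topspace T. E `` {p} \<in> W}"
    have "{p \<in> topspace T. E `` {p} \<in> S \<inter> W} =
        {p \<in> topspace T. E `` {p} \<in> S} \<inter> {p \<in> topspace T. E `` {p} \<in> W}"
      by blast
    then show "openin T {p \<in> topspace T. E `` {p} \<in> S \<inter> W}"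
      using S W by auto
    show "S \<inter> W \<subseteq> topspace T // E"
      using S by blast
  next
    fix \<K>
    assume K: "\<forall>K\<in>\<K>. K \<subseteq> topspace T // E \<and> openin T {p \<in> topspace T. E `` {p} \<in> K}"
    have "{p \<in> topspace T. E `` {p} \<in> \<Union>\<K>} = (\<Union>K\<in>\<K>. {p \<in> topspace T. E `` {p} \<in> K})"
      by blast
    then show "openin T {p \<in> topspace T. E `` {p} \<in> \<Union>\<K>}"
      using K by auto
    show "\<Union>\<K> \<subseteq> topspace T // E"
      using K by blast
  qed
  then show ?thesis
    by (simp add: quotient_topology_def)
qed

definition Z_space ::
    "('f \<Rightarrow> nat) \<Rightarrow> ('f, 'm) algebra set \<Rightarrow> ('f, 'm) carriers \<Rightarrow> ('f, 'a) algebra \<Rightarrow>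
     ('a, 'm) ypoint set ordered_space" where
  "Z_space ar \<M> \<Omega> A =
     \<lparr>top_of = quotient_topology (Y_top ar \<M> \<Omega> A) (Y_equiv ar \<M> \<Omega> A),
      ord_of = {(Y_class ar \<M> \<Omega> A y, Y_class ar \<M> \<Omega> A y') | y y'. (y, y') \<in> Y_preord ar \<M> \<Omega> A}\<rparr>"

definition Z_pointed ::
    "('f \<Rightarrow> nat) \<Rightarrow> ('f, 'm) algebra set \<Rightarrow> ('f, 'm) carriers \<Rightarrow> ('f, 'a) algebra \<Rightarrow>
     ('a, 'm) ypoint set \<Rightarrow> ('a, 'm) ypoint set \<Rightarrow> ('a, 'm) ypoint set pointed_space" where
  "Z_pointed ar \<M> \<Omega> A z\<^sub>1 z\<^sub>0 =
     ordered_space.extend (Z_space ar \<M> \<Omega> A) \<lparr>pt1 = z\<^sub>1, pt0 = z\<^sub>0\<rparr>"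

definition evaluation :: "('f, 'a) algebra \<Rightarrow> ('a, 'm) ypoint \<Rightarrow> 'a \<Rightarrow> bool" where
  "evaluation A = (\<lambda>(x, \<omega>). compose (universe A) \<omega> x)"

definition \<Psi> :: "('f, 'a) algebra \<Rightarrow> ('a, 'm) ypoint set \<Rightarrow> 'a \<Rightarrow> bool" where
  "\<Psi> A z = the_elem (evaluation A ` z)"

end

theory Submission
  imports Defs
begin

text \<open>Evaluation \<open>(x, \<omega>) \<mapsto> \<omega> \<circ> x\<close> is a continuous map from \<open>Y\<close> to the set of lattice homomorphisms from
  the reduct of \<open>A\<close> to \<^const>\<open>two\<close>, and the theorem says that \<open>Z\<close> is the quotient of \<open>Y\<close> by it.

  For the order, \<open>(x, \<omega>) \<preceq> (x', \<omega>')\<close> holds exactly if \<open>\<omega> \<circ> x \<le> \<omega>' \<circ> x'\<close> pointwise: the image of \<open>A\<close>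
  under \<open>(x, x')\<close> is then a subalgebra on which \<open>\<omega> a \<le> \<omega>' b\<close>, and finiteness of the sorts extends it
  to a maximal one (\<open>Y_preord_iff\<close>). So \<open>\<Psi>\<close> is well defined, injective and an order embedding.

  For surjectivity, \<open>Y\<close> is compact (\<open>compact_Y_top\<close>), so the image of evaluation is closed. It
  separates the points of \<open>A\<close>: a homomorphism into some sort tells two points apart, and then a
  carrier does so, possibly after a map in \<open>G\<close> (\<open>evaluation_surj\<close>).
  It also contains the two constant maps, through
  the one-element subalgebras. A closed set of lattice homomorphisms that separates points and
  contains the constants contains all homomorphisms (\<open>separating_closed_set_of_homs\<close>). This is
  an elementary density argument with a finite meet and a finite join, and takes the place of an
  appeal to Priestley duality.

  For the topology, a continuous surjection from a compact space onto a Hausdorff space is a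
  quotient map, so \<open>\<Psi>\<close> is a homeomorphism (\<open>homeomorphic_map_quotient_topology\<close>). The pointed
  structure follows along \<open>\<Psi>\<close>, since the homomorphisms form a closed subset of a power of the
  two-element space.\<close>

section \<open>Homomorphisms and term operations\<close>

lemma hom_funcset: "x \<in> hom ar A B \<Longrightarrow> x \<in> universe A \<rightarrow>\<^sub>E universe B"
  by (simp add: hom_def)

lemma hom_interp:
  "x \<in> hom ar A B \<Longrightarrow> length xs = ar f \<Longrightarrow> set xs \<subseteq> universe A \<Longrightarrow>
    x (interp A f xs) = interp B f (map x xs)"
  by (simp add: hom_def)

lemma hom_in: "x \<in> hom ar A B \<Longrightarrow> a \<in> universe A \<Longrightarrow> x a \<in> universe B"
  by (auto dest: hom_funcset)

lemma hom_compose: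
  assumes A: "is_algebra ar A" and x: "x \<in> hom ar A B" and y: "y \<in> hom ar B C"
  shows "compose (universe A) y x \<in> hom ar A C"
proof -
  have "compose (universe A) y x (interp A f xs) = interp C f (map (compose (universe A) y x) xs)"
    if xs: "length xs = ar f" "set xs \<subseteq> universe A" for f xs
  proof -
    have "interp A f xs \<in> universe A"
      using A xs by (simp add: is_algebra_def)
    then have "compose (universe A) y x (interp A f xs) = y (interp B f (map x xs))"
      by (simp add: compose_eq hom_interp[OF x xs])
    also have "\<dots> = interp C f (map y (map x xs))"
      using xs hom_in[OF x] by (intro hom_interp[OF y]) auto
    also have "map y (map x xs) = map (compose (universe A) y x) xs"
      using xs by (auto simp: compose_eq)
    finally show ?thesis .
  qed
  moreover have "compose (universe A) y x \<in> universe A \<rightarrow>\<^sub>E universe C"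
    using hom_in[OF x] hom_in[OF y] by (auto simp: compose_def)
  ultimately show ?thesis
    by (simp add: hom_def)
qed

lemma hom_image_subuniverse:
  assumes A: "is_algebra ar A" and h: "h \<in> hom ar A B"
  shows "subuniverse ar B (h ` universe A)"
  unfolding subuniverse_def
proof (intro conjI allI impI)
  show "h ` universe A \<subseteq> universe B"
    using hom_in[OF h] by blast
  show "h ` universe A \<noteq> {}"
    using A by (simp add: is_algebra_def)
  fix f ys
  assume ys: "length ys = ar f \<and> set ys \<subseteq> h ` universe A"
  then have "\<forall>y\<in>set ys. \<exists>a. a \<in> universe A \<and> y = h a"
    by blast
  then obtain g where g: "\<And>y. y \<in> set ys \<Longrightarrow> g y \<in> universe A \<and> y = h (g y)"
    by metis
  have "map h (map g ys) = map (\<lambda>y. y) ys"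
    unfolding map_map using g by (intro map_cong) auto
  then have "map h (map g ys) = ys"
    by simp
  then have "interp B f ys = h (interp A f (map g ys))"
    using hom_interp[OF h, of "map g ys" f] ys g by (metis image_subset_iff length_map list.set_map)
  moreover have "set (map g ys) \<subseteq> universe A"
    using g by auto
  then have "interp A f (map g ys) \<in> universe A"
    using A ys by (simp add: is_algebra_def)
  ultimately show "interp B f ys \<in> h ` universe A"
    by blast
qed

lemma hom_pair:
  assumes A: "is_algebra ar A" and x: "x \<in> hom ar A M" and x': "x' \<in> hom ar A M'"
  shows "(\<lambda>a\<in>universe A. (x a, x' a)) \<in> hom ar A (pair_algebra M M')"
proof -
  let ?p = "\<lambda>a\<in>universe A. (x a, x' a)"
  have "?p (interp A f xs) = interp (pair_algebra M M') f (map ?p xs)"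
    if xs: "length xs = ar f" "set xs \<subseteq> universe A" for f xs
  proof -
    have "map fst (map ?p xs) = map x xs" "map snd (map ?p xs) = map x' xs"
      using xs by auto
    moreover have "interp A f xs \<in> universe A"
      using A xs by (simp add: is_algebra_def)
    ultimately show ?thesis
      using hom_interp[OF x xs] hom_interp[OF x' xs] by (simp add: pair_algebra_def del: map_map)
  qed
  moreover have "?p \<in> universe A \<rightarrow>\<^sub>E universe (pair_algebra M M')"
    using hom_in[OF x] hom_in[OF x'] by (simp add: pair_algebra_def)
  ultimately show ?thesis
    by (simp add: hom_def)
qed

lemma hom_constant:
  assumes A: "is_algebra ar A" and d: "subuniverse ar M {d}"
  shows "(\<lambda>a\<in>universe A. d) \<in> hom ar A M"
proof -
  have "interp M f (map (\<lambda>a\<in>universe A. d) xs) = d"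
    if "length xs = ar f" "set xs \<subseteq> universe A" for f xs
  proof -
    have "set (map (\<lambda>a\<in>universe A. d) xs) \<subseteq> {d}"
      using that by auto
    then show ?thesis
      using d that unfolding subuniverse_def by (metis length_map singletonD)
  qed
  then show ?thesis
    using A d by (auto simp: hom_def is_algebra_def subuniverse_def)
qed

text \<open>Only the variables that can occur in the term matter, hence the separate valuation \<open>w\<close> on the
  target side: indexing a list and its image agree only below the length of the list.\<close>

lemma eval_hom:
  assumes A: "is_algebra ar A" and x: "x \<in> hom ar A B"
    and v: "\<And>i. i < k \<Longrightarrow> v i \<in> universe A \<and> w i = x (v i)"
  shows "term_of_arity ar k t \<Longrightarrow> eval A v t \<in> universe A \<and> x (eval A v t) = eval B w t"
proof (induction t)
  case (Var n)
  then show ?case using v by simp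
next
  case (App f ts)
  then have IH: "\<And>t. t \<in> set ts \<Longrightarrow> eval A v t \<in> universe A \<and> x (eval A v t) = eval B w t"
    and len: "length ts = ar f"
    by auto
  have sub: "set (map (eval A v) ts) \<subseteq> universe A"
    using IH by auto
  have "map x (map (eval A v) ts) = map (eval B w) ts"
    using IH by simp
  then show ?case
    using A sub len hom_interp[OF x _ sub, of f] by (simp add: is_algebra_def del: map_map)
qed

lemma reduct_hom:
  assumes A: "is_algebra ar A" and \<tau>: "\<And>l. term_of_arity ar 2 (\<tau> l)" and x: "x \<in> hom ar A B"
  shows "x \<in> hom lat_ar (reduct \<tau> A) (reduct \<tau> B)"
proof -
  have "x (eval A ((!) xs) (\<tau> l)) = eval B ((!) (map x xs)) (\<tau> l)"
    if "length xs = 2" "set xs \<subseteq> universe A" for l xs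
    using eval_hom[OF A x, of 2 "(!) xs" "(!) (map x xs)" "\<tau> l"] that \<tau>
    by (simp add: subset_iff)
  then show ?thesis
    using hom_funcset[OF x] by (auto simp: hom_def reduct_def)
qed

lemma hom_id: "is_algebra ar A \<Longrightarrow> (\<lambda>a\<in>universe A. a) \<in> hom ar A A"
proof -
  assume A: "is_algebra ar A"
  have "map (\<lambda>a\<in>universe A. a) xs = xs" if "set xs \<subseteq> universe A" for xs
    using that by (intro map_idI) auto
  then show ?thesis
    using A by (auto simp: hom_def is_algebra_def)
qed

lemma reduct_is_algebra:
  assumes A: "is_algebra ar A" and \<tau>: "\<And>l. term_of_arity ar 2 (\<tau> l)"
  shows "is_algebra lat_ar (reduct \<tau> A)"
proof -
  have "eval A ((!) xs) (\<tau> l) \<in> universe A" if "length xs = 2" "set xs \<subseteq> universe A" for l xs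
    using eval_hom[OF A hom_id[OF A], of 2 "(!) xs" "(!) xs" "\<tau> l"] that \<tau>
    by (simp add: subset_iff)
  then show ?thesis
    using A by (simp add: is_algebra_def reduct_def)
qed

lemma universe_reduct [simp]: "universe (reduct \<tau> A) = universe A"
  by (simp add: reduct_def)

text \<open>Two points of a subalgebra of a product differ in some coordinate, and coordinate
  projections are homomorphisms.\<close>

lemma in_ISP_separated:
  fixes A :: "('f, 'a) algebra"
  assumes A: "in_ISP TYPE('i) ar \<M> A" and ab: "a \<in> universe A" "b \<in> universe A" "a \<noteq> b"
  shows "\<exists>M\<in>\<M>. \<exists>x\<in>hom ar A M. x a \<noteq> x b"
proof -
  obtain I :: "'i set" and F S h where F: "F \<in> I \<rightarrow> \<M>"
    and S: "subuniverse ar (product_algebra I F) S"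
    and h: "h \<in> hom ar A (subalgebra (product_algebra I F) S)"
    and bij: "bij_betw h (universe A) S" and alg: "is_algebra ar A"
    using A by (auto simp: in_ISP_def isomorphic_def subalgebra_def)
  have S_PiE: "S \<subseteq> (\<Pi>\<^sub>E i\<in>I. universe (F i))"
    using S by (simp add: subuniverse_def product_algebra_def)
  have h_PiE: "h c \<in> (\<Pi>\<^sub>E i\<in>I. universe (F i))" if "c \<in> universe A" for c
    using S_PiE hom_in[OF h that] by (auto simp: subalgebra_def)
  have "h a \<noteq> h b"
    using bij ab by (auto simp: bij_betw_def dest: inj_onD)
  then obtain i where i: "i \<in> I" "h a i \<noteq> h b i"
    using PiE_ext[OF h_PiE[OF ab(1)] h_PiE[OF ab(2)]] by blast
  have "(\<lambda>c\<in>universe A. h c i) \<in> hom ar A (F i)"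
  proof -
    have "h (interp A f xs) i = interp (F i) f (map (\<lambda>c\<in>universe A. h c i) xs)"
      if xs: "length xs = ar f" "set xs \<subseteq> universe A" for f xs
    proof -
      have "map (\<lambda>c\<in>universe A. h c i) xs = map (\<lambda>y. y i) (map h xs)"
        using xs by auto
      then show ?thesis
        using hom_interp[OF h xs] i by (simp add: subalgebra_def product_algebra_def del: map_map)
    qed
    then show ?thesis
      using h_PiE i alg by (auto simp: hom_def is_algebra_def)
  qed
  then show ?thesis
    using i F ab by (intro bexI[of _ "F i"] bexI[of _ "\<lambda>c\<in>universe A. h c i"]) auto
qed


section \<open>Powers of discrete spaces\<close>

text \<open>With finitely many witnessing coordinates in place of basic open sets, the topological arguments
  below become finite combinatorics.\<close>

lemma openin_discrete_power:
  "openin (product_topology (\<lambda>_. discrete_topology D) I) P \<longleftrightarrow>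
     P \<subseteq> (\<Pi>\<^sub>E i\<in>I. D) \<and>
     (\<forall>x\<in>P. \<exists>J. finite J \<and> J \<subseteq> I \<and> (\<forall>y \<in> (\<Pi>\<^sub>E i\<in>I. D). (\<forall>j\<in>J. y j = x j) \<longrightarrow> y \<in> P))"
  (is "?L \<longleftrightarrow> ?R")
proof
  assume L: ?L
  have sub: "P \<subseteq> (\<Pi>\<^sub>E i\<in>I. D)"
    using openin_subset[OF L] by simp
  moreover have "\<exists>J. finite J \<and> J \<subseteq> I \<and> (\<forall>y \<in> (\<Pi>\<^sub>E i\<in>I. D). (\<forall>j\<in>J. y j = x j) \<longrightarrow> y \<in> P)"
    if x: "x \<in> P" for x
  proof -
    obtain U where U: "finite {i \<in> I. U i \<noteq> D}" "x \<in> Pi\<^sub>E I U" "Pi\<^sub>E I U \<subseteq> P"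
      using L x unfolding openin_product_topology_alt by auto
    have "y \<in> Pi\<^sub>E I U" if y: "y \<in> (\<Pi>\<^sub>E i\<in>I. D)" "\<forall>j\<in>{i \<in> I. U i \<noteq> D}. y j = x j" for y
    proof (rule PiE_I)
      fix i assume "i \<in> I"
      then show "y i \<in> U i"
        using y U(2) by (cases "U i = D") (auto simp: PiE_iff)
    qed (use y in \<open>auto simp: PiE_iff extensional_def\<close>)
    then have "y \<in> P" if "y \<in> (\<Pi>\<^sub>E i\<in>I. D)" "\<forall>j\<in>{i \<in> I. U i \<noteq> D}. y j = x j" for y
      using U(3) that by blast
    moreover have "{i \<in> I. U i \<noteq> D} \<subseteq> I"
      by blast
    ultimately show ?thesis
      using U(1) by (intro exI[of _ "{i \<in> I. U i \<noteq> D}"]) simp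
  qed
  ultimately show ?R by (intro conjI ballI)
next
  assume R: ?R
  show ?L
    unfolding openin_product_topology_alt
  proof
    fix x assume x: "x \<in> P"
    obtain J where J: "finite J" "J \<subseteq> I"
        "\<forall>y \<in> (\<Pi>\<^sub>E i\<in>I. D). (\<forall>j\<in>J. y j = x j) \<longrightarrow> y \<in> P"
      using bspec[OF conjunct2[OF R] x] by (elim exE conjE)
    have xD: "x \<in> (\<Pi>\<^sub>E i\<in>I. D)"
      using conjunct1[OF R] x by (rule subsetD)
    let ?U = "\<lambda>i. if i \<in> J then {x i} else D"
    have "finite {i \<in> I. ?U i \<noteq> D}"
      using J(1) by (rule rev_finite_subset) auto
    moreover have "Pi\<^sub>E I ?U \<subseteq> P"
    proof
      fix y assume y: "y \<in> Pi\<^sub>E I ?U"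
      have yJ: "y j = x j" if "j \<in> J" for j
        using PiE_mem[OF y, of j] J(2) that by auto
      have "y i \<in> D" if "i \<in> I" for i
        using PiE_mem[OF y that] PiE_mem[OF xD that] yJ[of i] by (cases "i \<in> J") auto
      then have "y \<in> (\<Pi>\<^sub>E i\<in>I. D)"
        using y by (simp add: PiE_iff)
      moreover have "\<forall>j\<in>J. y j = x j"
        using yJ by blast
      ultimately show "y \<in> P" using J(3) by simp
    qed
    moreover have "x \<in> Pi\<^sub>E I ?U"
      using xD by (auto simp: PiE_iff)
    moreover have "\<forall>i\<in>I. openin (discrete_topology D) (?U i)"
      using xD by (auto simp: PiE_iff)
    ultimately show "\<exists>U. finite {i \<in> I. U i \<noteq> topspace (discrete_topology D)} \<and>
        (\<forall>i\<in>I. openin (discrete_topology D) (U i)) \<and> x \<in> Pi\<^sub>E I U \<and> Pi\<^sub>E I U \<subseteq> P"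
      by (intro exI[of _ ?U]) simp
  qed
qed

text \<open>Whether an equation \<open>x (f as) = f (x as)\<close> fails is decided by the finitely many coordinates
  \<open>as\<close> and \<open>f as\<close>, so failing to be a homomorphism is an open condition.\<close>

lemma closedin_hom:
  assumes A: "is_algebra ar A"
  shows "closedin (product_topology (\<lambda>_. discrete_topology (universe M)) (universe A)) (hom ar A M)"
proof -
  let ?P = "\<Pi>\<^sub>E a\<in>universe A. universe M"
  have "\<exists>J. finite J \<and> J \<subseteq> universe A \<and>
      (\<forall>y \<in> ?P. (\<forall>j\<in>J. y j = x j) \<longrightarrow> y \<in> ?P - hom ar A M)"
    if x: "x \<in> ?P - hom ar A M" for x
  proof -
    obtain f xs where f: "length xs = ar f" "set xs \<subseteq> universe A"
        "x (interp A f xs) \<noteq> interp M f (map x xs)"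
      using x unfolding hom_def by blast
    have "y \<notin> hom ar A M" if "\<forall>j \<in> insert (interp A f xs) (set xs). y j = x j" for y
    proof
      assume "y \<in> hom ar A M"
      then have "y (interp A f xs) = interp M f (map y xs)"
        using f by (auto intro: hom_interp)
      moreover have "map y xs = map x xs"
        using that by simp
      ultimately show False
        using f that by simp
    qed
    moreover have "insert (interp A f xs) (set xs) \<subseteq> universe A"
      using A f by (simp add: is_algebra_def)
    ultimately show ?thesis
      by (intro exI[of _ "insert (interp A f xs) (set xs)"]) auto
  qed
  then have "openin (product_topology (\<lambda>_. discrete_topology (universe M)) (universe A))
      (?P - hom ar A M)"
    unfolding openin_discrete_power by (intro conjI ballI Diff_subset)
  then show ?thesis
    by (auto simp: closedin_def dest: hom_funcset)
qed


section \<open>Separating sets of lattice homomorphisms\<close>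

lemma universe_two [simp]: "universe two = UNIV"
  by (simp add: two_def)

lemma hom_two_meet:
  assumes "w \<in> hom lat_ar L two" "a \<in> universe L" "b \<in> universe L"
  shows "w (interp L Meet [a, b]) \<longleftrightarrow> w a \<and> w b"
  using hom_interp[OF assms(1), of "[a, b]" Meet] assms by (simp add: two_def)

lemma hom_two_join:
  assumes "w \<in> hom lat_ar L two" "a \<in> universe L" "b \<in> universe L"
  shows "w (interp L Join [a, b]) \<longleftrightarrow> w a \<or> w b"
  using hom_interp[OF assms(1), of "[a, b]" Join] assms by (simp add: two_def)

text \<open>A non-constant \<open>h\<close> is a limit of any separating set: finitely many elements where \<open>h\<close> is 1
  have a meet \<open>a\<close>, finitely many where \<open>h\<close> is 0 have a join \<open>b\<close>, and \<open>h\<close> shows that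
  \<open>a \<and> b \<noteq> a\<close>. A \<open>w\<close> that separates these two has \<open>w a = 1\<close> and \<open>w b = 0\<close>, and so agrees with
  \<open>h\<close> on all the given elements. The constants are not limits in general, since the empty
  meet and join need not exist.\<close>

lemma separating_closed_set_of_homs:
  assumes L: "is_algebra lat_ar L"
    and W: "W \<subseteq> hom lat_ar L two"
    and closed: "closedin (product_topology (\<lambda>_. discrete_topology UNIV) (universe L)) W"
    and sep: "\<And>a b. a \<in> universe L \<Longrightarrow> b \<in> universe L \<Longrightarrow> a \<noteq> b \<Longrightarrow> \<exists>w\<in>W. w a \<noteq> w b"
    and const1: "(\<lambda>a\<in>universe L. True) \<in> W"
    and const0: "(\<lambda>a\<in>universe L. False) \<in> W"
  shows "W = hom lat_ar L two"
proof (rule antisym[OF W], rule subsetI)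
  fix h assume h: "h \<in> hom lat_ar L two"
  have cl: "interp L l [a, b] \<in> universe L" if "a \<in> universe L" "b \<in> universe L" for l a b
    using L that by (simp add: is_algebra_def)
  have ext: "h \<in> (\<Pi>\<^sub>E a\<in>universe L. UNIV)"
    using hom_funcset[OF h] by (auto simp: PiE_iff)
  show "h \<in> W"
  proof (rule ccontr)
    assume nW: "h \<notin> W"
    have "h \<noteq> (\<lambda>a\<in>universe L. True)" "h \<noteq> (\<lambda>a\<in>universe L. False)"
      using nW const1 const0 by auto
    then obtain a0 b0 where a0: "a0 \<in> universe L" "h a0" and b0: "b0 \<in> universe L" "\<not> h b0"
      using ext by (auto simp: PiE_iff fun_eq_iff extensional_def split: if_splits)
    have "openin (product_topology (\<lambda>_. discrete_topology UNIV) (universe L))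
        ((\<Pi>\<^sub>E a\<in>universe L. UNIV) - W)"
      using closed by (simp add: closedin_def)
    then obtain J where J: "finite J" "J \<subseteq> universe L"
      and out: "\<And>y. y \<in> (\<Pi>\<^sub>E a\<in>universe L. UNIV) \<Longrightarrow> \<forall>j\<in>J. y j = h j \<Longrightarrow> y \<notin> W"
      unfolding openin_discrete_power using ext nW by (metis (lifting) DiffD2 DiffI)
    have meet: "\<exists>a\<in>universe L. h a \<and> (\<forall>w\<in>hom lat_ar L two. w a \<longrightarrow> (\<forall>c\<in>F. w c))"
      if "finite F" "F \<subseteq> {c \<in> universe L. h c}" for F
      using that
    proof (induction F)
      case empty
      then show ?case using a0 by auto
    next
      case (insert c F)
      then obtain a where a: "a \<in> universe L" "h a"
          "\<forall>w\<in>hom lat_ar L two. w a \<longrightarrow> (\<forall>c\<in>F. w c)"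
        by auto
      then show ?case
        using insert.prems h cl by (intro bexI[of _ "interp L Meet [c, a]"]) (auto simp: hom_two_meet)
    qed
    have join: "\<exists>b\<in>universe L. \<not> h b \<and> (\<forall>w\<in>hom lat_ar L two. \<not> w b \<longrightarrow> (\<forall>c\<in>F. \<not> w c))"
      if "finite F" "F \<subseteq> {c \<in> universe L. \<not> h c}" for F
      using that
    proof (induction F)
      case empty
      then show ?case using b0 by auto
    next
      case (insert c F)
      then obtain b where b: "b \<in> universe L" "\<not> h b"
          "\<forall>w\<in>hom lat_ar L two. \<not> w b \<longrightarrow> (\<forall>c\<in>F. \<not> w c)"
        by auto
      then show ?case
        using insert.prems h cl by (intro bexI[of _ "interp L Join [c, b]"]) (auto simp: hom_two_join)
    qed
    \<comment> \<open>Any \<open>w\<close> separating \<open>a\<close> from \<open>a \<and> b\<close> will lie in \<open>W\<close> and agree with \<open>h\<close> on \<open>J\<close>, against the choice of \<open>J\<close>.\<close>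
    obtain a where a: "a \<in> universe L" "h a"
        "\<And>w c. w \<in> hom lat_ar L two \<Longrightarrow> w a \<Longrightarrow> c \<in> J \<Longrightarrow> h c \<Longrightarrow> w c"
    proof -
      have "finite {c \<in> J. h c}" "{c \<in> J. h c} \<subseteq> {c \<in> universe L. h c}"
        using J by auto
      from meet[OF this] show thesis
        by (elim bexE conjE, intro that) auto
    qed
    obtain b where b: "b \<in> universe L" "\<not> h b"
        "\<And>w c. w \<in> hom lat_ar L two \<Longrightarrow> \<not> w b \<Longrightarrow> c \<in> J \<Longrightarrow> \<not> h c \<Longrightarrow> \<not> w c"
    proof -
      have "finite {c \<in> J. \<not> h c}" "{c \<in> J. \<not> h c} \<subseteq> {c \<in> universe L. \<not> h c}"
        using J by auto
      from join[OF this] show thesis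
        by (elim bexE conjE, intro that) auto
    qed
    have "interp L Meet [a, b] \<noteq> a"
      using hom_two_meet[OF h a(1) b(1)] a(2) b(2) by auto
    then obtain w where w: "w \<in> W" "w (interp L Meet [a, b]) \<noteq> w a"
      using sep cl a(1) b(1) by meson
    then have wh: "w \<in> hom lat_ar L two"
      using W by blast
    have "w a" "\<not> w b"
      using w(2) hom_two_meet[OF wh a(1) b(1)] by auto
    then have "\<forall>j\<in>J. w j = h j"
      using a(3)[OF wh] b(3)[OF wh] by blast
    moreover have "w \<in> (\<Pi>\<^sub>E a\<in>universe L. UNIV)"
      using hom_funcset[OF wh] by (auto simp: PiE_iff)
    ultimately show False
      using out w(1) by blast
  qed
qed


section \<open>Compact quotients\<close>

lemma topspace_quotient_topology: "topspace (quotient_topology T E) = topspace T // E"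
proof -
  have "{p \<in> topspace T. E `` {p} \<in> topspace T // E} = topspace T"
    by (auto simp: quotient_def)
  then have "openin (quotient_topology T E) (topspace T // E)"
    by (simp add: openin_quotient_topology)
  then show ?thesis
    by (meson openin_quotient_topology openin_subset openin_topspace subset_antisym)
qed

text \<open>A continuous map from a compact space to a Hausdorff space is closed, so a surjective one
  is a quotient map.\<close>

lemma homeomorphic_map_quotient_topology:
  assumes T: "compact_space T" and Q: "Hausdorff_space Q"
    and f: "continuous_map T Q f" and surj: "f ` topspace T = topspace Q"
    and g: "\<And>p. p \<in> topspace T \<Longrightarrow> g (E `` {p}) = f p"
    and E: "\<And>p q. p \<in> topspace T \<Longrightarrow> q \<in> topspace T \<Longrightarrow> f p = f q \<Longrightarrow> E `` {p} = E `` {q}"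
  shows "homeomorphic_map (quotient_topology T E) Q g"
  unfolding homeomorphic_map_def
proof
  have quot: "quotient_map T Q f"
    using continuous_closed_imp_quotient_map[OF f continuous_imp_closed_map[OF f T Q] surj] .
  have img: "g ` (topspace T // E) = topspace Q"
    using surj g by (force simp: quotient_def image_iff)
  moreover have "openin (quotient_topology T E) {z \<in> topspace T // E. g z \<in> U} \<longleftrightarrow> openin Q U"
    if "U \<subseteq> topspace Q" for U
  proof -
    have "{p \<in> topspace T. E `` {p} \<in> {z \<in> topspace T // E. g z \<in> U}} = {p \<in> topspace T. f p \<in> U}"
      using g by (auto simp: quotient_def)
    then show ?thesis
      using quot that by (simp add: openin_quotient_topology quotient_map_def)
  qed
  ultimately show "quotient_map (quotient_topology T E) Q g"
    by (simp add: quotient_map_def topspace_quotient_topology)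
  show "inj_on g (topspace (quotient_topology T E))"
    unfolding topspace_quotient_topology
  proof (rule inj_onI)
    fix z z' assume z: "z \<in> topspace T // E" "z' \<in> topspace T // E" and eq: "g z = g z'"
    obtain p p' where "p \<in> topspace T" "z = E `` {p}" "p' \<in> topspace T" "z' = E `` {p'}"
      using z by (elim quotientE)
    then show "z = z'"
      using eq g E by metis
  qed
qed


section \<open>The space Y and evaluation\<close>

lemma topspace_dual_top: "topspace (dual_top ar A M) = hom ar A M"
  by (auto simp: dual_top_def dest: hom_funcset)

lemma topspace_Y_top: "topspace (Y_top ar \<M> \<Omega> A) = Y_set ar \<M> \<Omega> A"
proof -
  let ?B = "{U \<times> {\<omega>} |U \<omega>. \<exists>M\<in>\<M>. openin (dual_top ar A M) U \<and> \<omega> \<in> \<Omega> M}"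
  have "\<Union>?B = Y_set ar \<M> \<Omega> A"
  proof
    show "\<Union>?B \<subseteq> Y_set ar \<M> \<Omega> A"
    proof (rule Union_least)
      fix V assume "V \<in> ?B"
      then obtain U \<omega> M where "V = U \<times> {\<omega>}" "M \<in> \<M>" "openin (dual_top ar A M) U" "\<omega> \<in> \<Omega> M"
        by blast
      then show "V \<subseteq> Y_set ar \<M> \<Omega> A"
        using openin_subset[of "dual_top ar A M" U] unfolding topspace_dual_top Y_set_def by blast
    qed
    show "Y_set ar \<M> \<Omega> A \<subseteq> \<Union>?B"
    proof
      fix y assume "y \<in> Y_set ar \<M> \<Omega> A"
      then obtain M where "M \<in> \<M>" "fst y \<in> hom ar A M" "snd y \<in> \<Omega> M"
        by (auto simp: Y_set_def)
      moreover have "openin (dual_top ar A M) (hom ar A M)"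
        using openin_topspace[of "dual_top ar A M"] by (simp add: topspace_dual_top)
      ultimately have "hom ar A M \<times> {snd y} \<in> ?B" "y \<in> hom ar A M \<times> {snd y}"
        by (blast, simp add: mem_Times_iff)
      then show "y \<in> \<Union>?B"
        by (rule UnionI)
    qed
  qed
  then show ?thesis
    by (simp add: Y_top_def topology_generated_by_topspace)
qed

lemma openin_Y_top:
  "M \<in> \<M> \<Longrightarrow> \<omega> \<in> \<Omega> M \<Longrightarrow> openin (dual_top ar A M) U \<Longrightarrow> openin (Y_top ar \<M> \<Omega> A) (U \<times> {\<omega>})"
  unfolding Y_top_def by (rule topology_generated_by_Basis) blast

lemma compact_dual_top:
  assumes "is_algebra ar A" "finite (universe M)"
  shows "compact_space (dual_top ar A M)"
proof -
  have "compact_space (product_topology (\<lambda>_. discrete_topology (universe M)) (universe A))"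
    using assms(2) by (simp add: compact_space_product_topology compact_space_discrete_topology)
  then show ?thesis
    unfolding dual_top_def
    using closedin_hom[OF assms(1), of M] closedin_compact_space compact_space_subtopology by blast
qed

text \<open>\<open>Y\<close> is covered by finitely many copies of compact spaces. A copy of \<open>X\<^sub>M\<close> embeds
  continuously because basic open sets that come from another sort do not meet it.\<close>

lemma compact_Y_top:
  fixes \<Omega> :: "('f, 'm) carriers"
  assumes A: "is_algebra ar A" and \<M>: "sorts ar \<M>"
    and fin: "\<And>M. M \<in> \<M> \<Longrightarrow> finite (\<Omega> M)"
  shows "compact_space (Y_top ar \<M> \<Omega> A)"
proof -
  have cont: "continuous_map (dual_top ar A M) (Y_top ar \<M> \<Omega> A) (\<lambda>x. (x, \<omega>))"
    if M: "M \<in> \<M>" and \<omega>: "\<omega> \<in> \<Omega> M" for M \<omega>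
    unfolding Y_top_def
  proof (rule continuous_on_generated_topo)
    fix V assume "V \<in> {U \<times> {\<omega>} |U \<omega>. \<exists>M\<in>\<M>. openin (dual_top ar A M) U \<and> \<omega> \<in> \<Omega> M}"
    then obtain U \<omega>' M' where V: "V = U \<times> {\<omega>'}" and M': "M' \<in> \<M>"
      and U: "openin (dual_top ar A M') U"
      by blast
    have subU: "U \<subseteq> hom ar A M'"
      using openin_subset[OF U] by (simp add: topspace_dual_top)
    have "U \<inter> hom ar A M = {}" if "M' \<noteq> M"
    proof (rule ccontr)
      assume "U \<inter> hom ar A M \<noteq> {}"
      then obtain x where "x \<in> hom ar A M'" "x \<in> hom ar A M"
        using subU by blast
      moreover obtain a where "a \<in> universe A"
        using A by (auto simp: is_algebra_def)
      ultimately have "x a \<in> universe M' \<inter> universe M"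
        by (simp add: hom_in)
      then show False
        using \<M> M M' that by (auto simp: sorts_def pairwise_def disjnt_def)
    qed
    then have "openin (dual_top ar A M) (U \<inter> hom ar A M)"
      using U openin_topspace[of "dual_top ar A M"]
      by (cases "M' = M") (auto simp: topspace_dual_top)
    moreover have "(\<lambda>x. (x, \<omega>)) -` V \<inter> hom ar A M = (if \<omega> = \<omega>' then U \<inter> hom ar A M else {})"
      using V by auto
    ultimately show "openin (dual_top ar A M) ((\<lambda>x. (x, \<omega>)) -` V \<inter> topspace (dual_top ar A M))"
      by (simp add: topspace_dual_top)
  next
    show "(\<lambda>x. (x, \<omega>)) ` topspace (dual_top ar A M)
        \<subseteq> \<Union> {U \<times> {\<omega>} |U \<omega>. \<exists>M\<in>\<M>. openin (dual_top ar A M) U \<and> \<omega> \<in> \<Omega> M}"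
      using M \<omega> openin_topspace[of "dual_top ar A M"] by blast
  qed
  have "compactin (Y_top ar \<M> \<Omega> A) ((\<lambda>x. (x, \<omega>)) ` hom ar A M)"
    if "M \<in> \<M>" "\<omega> \<in> \<Omega> M" for M \<omega>
    using image_compactin[OF _ cont[OF that], of "hom ar A M"] compact_dual_top[OF A, of M] \<M> that
    by (simp add: compact_space_def topspace_dual_top sorts_def)
  moreover have "Y_set ar \<M> \<Omega> A = (\<Union>M\<in>\<M>. \<Union>\<omega>\<in>\<Omega> M. (\<lambda>x. (x, \<omega>)) ` hom ar A M)"
    by (auto simp: Y_set_def)
  moreover have "finite \<M>"
    using \<M> by (simp add: sorts_def)
  ultimately have "compactin (Y_top ar \<M> \<Omega> A) (Y_set ar \<M> \<Omega> A)"
    using fin by (auto intro!: compactin_Union)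
  then show ?thesis
    by (simp add: compact_space_def topspace_Y_top)
qed

lemma continuous_evaluation:
  "continuous_map (Y_top ar \<M> \<Omega> A)
     (product_topology (\<lambda>_. discrete_topology UNIV) (universe A)) (evaluation A)"
  unfolding continuous_map_componentwise
proof (intro conjI ballI)
  show "evaluation A ` topspace (Y_top ar \<M> \<Omega> A) \<subseteq> extensional (universe A)"
    by (auto simp: evaluation_def compose_def)
  fix a assume a: "a \<in> universe A"
  have "openin (Y_top ar \<M> \<Omega> A) {y \<in> Y_set ar \<M> \<Omega> A. evaluation A y a \<in> B}" for B
  proof -
    have "openin (dual_top ar A M) {x \<in> hom ar A M. \<omega> (x a) \<in> B}" for M \<omega>
    proof -
      have "{x \<in> hom ar A M. \<omega> (x a) \<in> B} =
          {x \<in> \<Pi>\<^sub>E a\<in>universe A. universe M. \<omega> (x a) \<in> B} \<inter> hom ar A M"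
        by (auto dest: hom_funcset)
      moreover have "openin (product_topology (\<lambda>_. discrete_topology (universe M)) (universe A))
          {x \<in> \<Pi>\<^sub>E a\<in>universe A. universe M. \<omega> (x a) \<in> B}"
        unfolding openin_discrete_power using a by (auto intro!: exI[of _ "{a}"])
      ultimately show ?thesis
        unfolding dual_top_def by (simp add: openin_subtopology_Int)
    qed
    then have "openin (Y_top ar \<M> \<Omega> A)
        (\<Union>M\<in>\<M>. \<Union>\<omega>\<in>\<Omega> M. {x \<in> hom ar A M. \<omega> (x a) \<in> B} \<times> {\<omega>})"
      by (intro openin_Union) (auto intro!: openin_Y_top openin_Union)
    also have "(\<Union>M\<in>\<M>. \<Union>\<omega>\<in>\<Omega> M. {x \<in> hom ar A M. \<omega> (x a) \<in> B} \<times> {\<omega>}) =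
        {y \<in> Y_set ar \<M> \<Omega> A. evaluation A y a \<in> B}"
      using a by (auto simp: Y_set_def evaluation_def compose_def)
    finally show ?thesis .
  qed
  then show "continuous_map (Y_top ar \<M> \<Omega> A) (discrete_topology UNIV) (\<lambda>y. evaluation A y a)"
    by (simp add: continuous_map_def topspace_Y_top)
qed

text \<open>If \<open>\<omega> \<circ> x \<le> \<omega>' \<circ> x'\<close> pointwise, then the image of \<open>A\<close> under \<open>(x, x')\<close> is a subalgebra of
  \<open>M \<times> M'\<close> inside \<open>(\<omega>, \<omega>')\<^sup>-\<^sup>1(\<le>)\<close>; as \<open>M \<times> M'\<close> is finite, it lies in a maximal one.\<close>

lemma Y_preord_iff:
  fixes \<Omega> :: "('f, 'm) carriers"
  assumes A: "is_algebra ar A" and \<M>: "sorts ar \<M>"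
  shows "(y, y') \<in> Y_preord ar \<M> \<Omega> A \<longleftrightarrow>
     y \<in> Y_set ar \<M> \<Omega> A \<and> y' \<in> Y_set ar \<M> \<Omega> A \<and>
     (\<forall>a\<in>universe A. evaluation A y a \<le> evaluation A y' a)"
    (is "?L \<longleftrightarrow> ?R")
proof
  assume ?L
  then show ?R
    by (fastforce simp: Y_preord_def Y_set_def lift_rel_def alter_ego_rels_def Let_def
        evaluation_def compose_def)
next
  assume R: ?R
  obtain x \<omega> x' \<omega>' where y: "y = (x, \<omega>)" "y' = (x', \<omega>')"
    by fastforce
  obtain M M' where M: "M \<in> \<M>" "x \<in> hom ar A M" "\<omega> \<in> \<Omega> M"
    and M': "M' \<in> \<M>" "x' \<in> hom ar A M'" "\<omega>' \<in> \<Omega> M'"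
    using R y by (auto simp: Y_set_def)
  define admissible where "admissible r \<longleftrightarrow> subuniverse ar (pair_algebra M M') r \<and>
      r \<subseteq> {(a, b) \<in> universe M \<times> universe M'. \<omega> a \<le> \<omega>' b}" for r
  let ?r = "(\<lambda>a\<in>universe A. (x a, x' a)) ` universe A"
  have "admissible ?r"
    unfolding admissible_def
    using hom_image_subuniverse[OF A hom_pair[OF A M(2) M'(2)]] R y hom_in[OF M(2)] hom_in[OF M'(2)]
    by (auto simp: evaluation_def compose_def)
  moreover have "finite {r. admissible r}"
  proof (rule finite_subset)
    show "{r. admissible r} \<subseteq> Pow (universe M \<times> universe M')"
      unfolding admissible_def by auto
    show "finite (Pow (universe M \<times> universe M'))"
      using \<M> M(1) M'(1) by (simp add: sorts_def)
  qed
  ultimately obtain r where r: "admissible r" "?r \<subseteq> r"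
      "\<And>r'. admissible r' \<Longrightarrow> r \<subseteq> r' \<Longrightarrow> r' = r"
    using finite_has_maximal2[of "{r. admissible r}" ?r] by (metis mem_Collect_eq)
  then have "r \<in> alter_ego_rels ar M M' \<omega> \<omega>'"
    unfolding alter_ego_rels_def Let_def admissible_def by blast
  moreover have "(x, x') \<in> lift_rel ar A M M' r"
    using r(2) M(2) M'(2) by (auto simp: lift_rel_def)
  ultimately show ?L
    using M M' y unfolding Y_preord_def by blast
qed

lemma evaluation_hom:
  assumes A: "is_algebra ar A" and \<tau>: "\<And>l. term_of_arity ar 2 (\<tau> l)"
    and \<Omega>: "\<And>M. M \<in> \<M> \<Longrightarrow> \<Omega> M \<subseteq> hom lat_ar (reduct \<tau> M) two"
    and y: "y \<in> Y_set ar \<M> \<Omega> A"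
  shows "evaluation A y \<in> hom lat_ar (reduct \<tau> A) two"
proof -
  obtain x \<omega> M where M: "y = (x, \<omega>)" "M \<in> \<M>" "x \<in> hom ar A M" "\<omega> \<in> \<Omega> M"
    using y by (auto simp: Y_set_def)
  then show ?thesis
    using hom_compose[OF reduct_is_algebra[where \<tau> = \<tau>, OF A \<tau>]
        reduct_hom[where \<tau> = \<tau>, OF A \<tau> M(3)], of \<omega> two] \<Omega>
    by (auto simp: evaluation_def)
qed

lemma Y_equiv_iff:
  fixes \<Omega> :: "('f, 'm) carriers"
  assumes A: "is_algebra ar A" and \<M>: "sorts ar \<M>"
  shows "(y, y') \<in> Y_equiv ar \<M> \<Omega> A \<longleftrightarrow>
     y \<in> Y_set ar \<M> \<Omega> A \<and> y' \<in> Y_set ar \<M> \<Omega> A \<and> evaluation A y = evaluation A y'"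
proof -
  have "evaluation A y = evaluation A y'"
    if "\<forall>a\<in>universe A. evaluation A y a \<le> evaluation A y' a"
       "\<forall>a\<in>universe A. evaluation A y' a \<le> evaluation A y a"
  proof
    fix a
    show "evaluation A y a = evaluation A y' a"
      using that by (cases "a \<in> universe A") (auto simp: evaluation_def compose_def split: prod.splits)
  qed
  then show ?thesis
    by (auto simp: Y_equiv_def Y_preord_iff[OF A \<M>])
qed

text \<open>The evaluation image is closed, as \<open>Y\<close> is compact, and it separates points: homomorphisms
  into the sorts separate the points of \<open>A\<close>, and \<^const>\<open>Sep\<close> passes from sorts to carriers.\<close>

lemma evaluation_surj:
  fixes A :: "('f, 'a) algebra" and \<Omega> :: "('f, 'm) carriers"
  assumes \<tau>: "\<And>l. term_of_arity ar 2 (\<tau> l)"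
    and \<M>: "sorts ar \<M>"
    and \<Omega>: "\<And>M. M \<in> \<M> \<Longrightarrow> \<Omega> M \<subseteq> hom lat_ar (reduct \<tau> M) two"
    and fin: "\<And>M. M \<in> \<M> \<Longrightarrow> finite (\<Omega> M)"
    and G: "\<And>M M'. M \<in> \<M> \<Longrightarrow> M' \<in> \<M> \<Longrightarrow> G M M' \<subseteq> hom ar M M'"
    and Sep: "Sep \<M> G \<Omega>"
    and ISP: "in_ISP TYPE('i) ar \<M> A"
    and const1: "(\<lambda>a\<in>universe A. True) \<in> evaluation A ` Y_set ar \<M> \<Omega> A"
    and const0: "(\<lambda>a\<in>universe A. False) \<in> evaluation A ` Y_set ar \<M> \<Omega> A"
  shows "evaluation A ` Y_set ar \<M> \<Omega> A = hom lat_ar (reduct \<tau> A) two"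
proof (rule separating_closed_set_of_homs)
  have A: "is_algebra ar A"
    using ISP by (simp add: in_ISP_def)
  show "is_algebra lat_ar (reduct \<tau> A)"
    by (rule reduct_is_algebra[where \<tau> = \<tau>, OF A \<tau>])
  show "evaluation A ` Y_set ar \<M> \<Omega> A \<subseteq> hom lat_ar (reduct \<tau> A) two"
    using evaluation_hom[where \<tau> = \<tau>, OF A \<tau> \<Omega>] by blast
  have "compactin (product_topology (\<lambda>_. discrete_topology UNIV) (universe A))
      (evaluation A ` Y_set ar \<M> \<Omega> A)"
    using image_compactin[OF _ continuous_evaluation] compact_Y_top[where \<Omega> = \<Omega>, OF A \<M> fin]
    by (metis compact_space_def topspace_Y_top)
  moreover have "Hausdorff_space
      (product_topology (\<lambda>_. discrete_topology (UNIV :: bool set)) (universe A))"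
    by (simp add: Hausdorff_space_product_topology)
  ultimately show "closedin (product_topology (\<lambda>_. discrete_topology UNIV) (universe (reduct \<tau> A)))
      (evaluation A ` Y_set ar \<M> \<Omega> A)"
    by (simp add: compactin_imp_closedin)
  fix a b
  assume ab: "a \<in> universe (reduct \<tau> A)" "b \<in> universe (reduct \<tau> A)" "a \<noteq> b"
  have sepI: "\<exists>w\<in>evaluation A ` Y_set ar \<M> \<Omega> A. w a \<noteq> w b"
    if "M \<in> \<M>" "x \<in> hom ar A M" "\<omega> \<in> \<Omega> M" "\<omega> (x a) \<noteq> \<omega> (x b)" for M x \<omega>
    using that ab by (auto simp: Y_set_def evaluation_def compose_def intro!: bexI[of _ "(x, \<omega>)"])
  obtain M x where M: "M \<in> \<M>" and x: "x \<in> hom ar A M" "x a \<noteq> x b"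
    using in_ISP_separated[OF ISP, of a b] ab unfolding universe_reduct by blast
  consider \<omega> where "\<omega> \<in> \<Omega> M" "\<omega> (x a) \<noteq> \<omega> (x b)"
    | M' \<omega>' u where "M' \<in> \<M>" "\<omega>' \<in> \<Omega> M'" "u \<in> G M M'" "\<omega>' (u (x a)) \<noteq> \<omega>' (u (x b))"
    using Sep M x hom_in[OF x(1)] ab unfolding Sep_def by (metis universe_reduct)
  then show "\<exists>w\<in>evaluation A ` Y_set ar \<M> \<Omega> A. w a \<noteq> w b"
  proof cases
    case 1
    then show ?thesis using sepI M x by blast
  next
    case 2
    then have "compose (universe A) u x \<in> hom ar A M'"
      using hom_compose[OF A x(1)] G[OF M] by blast
    then show ?thesis
      using sepI[of M' "compose (universe A) u x" \<omega>'] 2 ab by (simp add: compose_eq)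
  qed
qed (use const1 const0 in simp_all)

lemma evaluation_constant:
  fixes \<Omega> :: "('f, 'm) carriers"
  assumes A: "is_algebra ar A"
    and d: "\<exists>M\<in>\<M>. \<exists>d. subuniverse ar M {d} \<and> (\<exists>\<omega>\<in>\<Omega> M. \<omega> d = c)"
  shows "(\<lambda>a\<in>universe A. c) \<in> evaluation A ` Y_set ar \<M> \<Omega> A"
proof -
  obtain M d \<omega> where M: "M \<in> \<M>" "subuniverse ar M {d}" "\<omega> \<in> \<Omega> M" "\<omega> d = c"
    using d by blast
  then have "(\<lambda>a\<in>universe A. d, \<omega>) \<in> Y_set ar \<M> \<Omega> A"
    using hom_constant[OF A M(2)] by (auto simp: Y_set_def)
  moreover have "evaluation A (\<lambda>a\<in>universe A. d, \<omega>) = (\<lambda>a\<in>universe A. c)"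
    using M(4) by (auto simp: evaluation_def compose_def fun_eq_iff)
  ultimately show ?thesis
    by (metis image_eqI)
qed


section \<open>The representation of Z\<close>

lemma \<Psi>_Y_class:
  fixes \<Omega> :: "('f, 'm) carriers"
  assumes A: "is_algebra ar A" and \<M>: "sorts ar \<M>" and y: "y \<in> Y_set ar \<M> \<Omega> A"
  shows "\<Psi> A (Y_class ar \<M> \<Omega> A y) = evaluation A y"
proof -
  have "evaluation A ` Y_class ar \<M> \<Omega> A y = {evaluation A y}"
    using y by (force simp: Y_equiv_iff[OF A \<M>])
  then show ?thesis
    by (simp add: \<Psi>_def)
qed

lemma order_homeomorphism_imp_pointed_isomorphism:
  assumes f: "order_homeomorphism P Q f"
    and P: "pointed_structure P" and Q: "pointed_structure Q"
    and pts: "f (pt1 P) = pt1 Q" "f (pt0 P) = pt0 Q"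
  shows "pointed_isomorphism P Q f"
proof -
  have hom: "homeomorphic_map (top_of P) (top_of Q) f"
    and ord: "\<And>p p'. p \<in> topspace (top_of P) \<Longrightarrow> p' \<in> topspace (top_of P) \<Longrightarrow>
        (p, p') \<in> ord_of P \<longleftrightarrow> (f p, f p') \<in> ord_of Q"
    using f by (auto simp: order_homeomorphism_def)
  obtain g where g: "homeomorphic_maps (top_of P) (top_of Q) f g"
    using hom homeomorphic_map_maps by blast
  then have fc: "continuous_map (top_of P) (top_of Q) f"
    and gc: "continuous_map (top_of Q) (top_of P) g"
    and gf: "\<And>p. p \<in> topspace (top_of P) \<Longrightarrow> g (f p) = p"
    and fg: "\<And>q. q \<in> topspace (top_of Q) \<Longrightarrow> f (g q) = q"
    by (auto simp: homeomorphic_maps_def)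
  have gin: "g q \<in> topspace (top_of P)" if "q \<in> topspace (top_of Q)" for q
    using gc that by (auto simp: continuous_map_def)
  have "pointed_morphism P Q f"
    using fc ord P pts by (auto simp: pointed_morphism_def pointed_structure_def)
  moreover have "pointed_morphism Q P g"
    unfolding pointed_morphism_def
  proof (intro conjI)
    show "\<forall>(q, q')\<in>ord_of Q. (g q, g q') \<in> ord_of P"
    proof clarify
      fix q q' assume q: "(q, q') \<in> ord_of Q"
      then have "q \<in> topspace (top_of Q)" "q' \<in> topspace (top_of Q)"
        using Q by (auto simp: pointed_structure_def)
      then show "(g q, g q') \<in> ord_of P"
        using q ord[of "g q" "g q'"] gin fg by simp
    qed
    show "g (pt1 Q) = pt1 P" "g (pt0 Q) = pt0 P"
      using gf P pts by (metis pointed_structure_def)+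
  qed (rule gc)
  ultimately show ?thesis
    using gf fg by (auto simp: pointed_isomorphism_def)
qed

lemma closed_pointed_subset_hom:
  assumes L: "is_algebra lat_ar L"
  shows "closed_pointed_subset (two_power (universe L)) (hom lat_ar L two)"
proof -
  have "closedin (product_topology (\<lambda>_. discrete_topology UNIV) (universe L)) (hom lat_ar L two)"
    using closedin_hom[OF L, of two] by simp
  moreover have "(\<lambda>a\<in>universe L. c) \<in> hom lat_ar L two" for c
    by (rule hom_constant[OF L])
      (auto simp: subuniverse_def two_def length_Suc_conv numeral_2_eq_2 split: lat_op.split)
  ultimately show ?thesis
    by (simp add: closed_pointed_subset_def two_power_def)
qed

lemma topspace_Hu: "topspace (top_of (Hu L)) = hom lat_ar L two"
  by (auto simp: Hu_def pointed_substructure_def two_power_def PiE_iff dest: hom_funcset)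

lemma pointed_structure_Hu: "is_algebra lat_ar L \<Longrightarrow> pointed_structure (Hu L)"
  using closed_pointed_subset_hom[of L] topspace_Hu[of L]
  by (auto simp: pointed_structure_def closed_pointed_subset_def Hu_def pointed_substructure_def)

lemma pointed_priestley_of_Hu_iso:
  fixes L :: "(lat_op, 'a) algebra"
  assumes "is_algebra lat_ar L" "pointed_structure P" "pointed_isomorphism P (Hu L) f"
  shows "pointed_priestley TYPE('a) P"
  using assms closed_pointed_subset_hom[OF assms(1)]
  unfolding pointed_priestley_def Hu_def is_algebra_def by blast

lemma pointed_isomorphism_id: "pointed_isomorphism P P id"
  by (auto simp: pointed_isomorphism_def pointed_morphism_def intro!: exI[of _ id])

lemma Hu_order:
  assumes "h \<in> hom lat_ar L two" "h' \<in> hom lat_ar L two"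
  shows "(h, h') \<in> ord_of (Hu L) \<longleftrightarrow> (\<forall>a\<in>universe L. h a \<le> h' a)"
  using assms hom_funcset[OF assms(1)] hom_funcset[OF assms(2)]
  by (auto simp: Hu_def pointed_substructure_def two_power_def PiE_iff)

text \<open>The classes are the fibres of evaluation, and the pre-order is the pointwise order of the values,
  so once evaluation is surjective both parts of the structure of \<open>Z\<close> are those of its target.\<close>

lemma order_homeomorphism_\<Psi>:
  fixes \<Omega> :: "('f, 'm) carriers"
  assumes A: "is_algebra ar A" and \<M>: "sorts ar \<M>"
    and fin: "\<And>M. M \<in> \<M> \<Longrightarrow> finite (\<Omega> M)"
    and surj: "evaluation A ` Y_set ar \<M> \<Omega> A = hom lat_ar (reduct \<tau> A) two"
  shows "order_homeomorphism (Z_space ar \<M> \<Omega> A) (Hu (reduct \<tau> A)) (\<Psi> A)"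
proof -
  let ?Y = "Y_set ar \<M> \<Omega> A" and ?T = "Y_top ar \<M> \<Omega> A" and ?E = "Y_equiv ar \<M> \<Omega> A"
    and ?H = "hom lat_ar (reduct \<tau> A) two"
  have top_Hu: "top_of (Hu (reduct \<tau> A)) =
      subtopology (product_topology (\<lambda>_. discrete_topology UNIV) (universe A)) ?H"
    by (simp add: Hu_def pointed_substructure_def two_power_def)
  have class_eq: "?E `` {y} = ?E `` {y'}"
    if "y \<in> ?Y" "y' \<in> ?Y" "evaluation A y = evaluation A y'" for y y'
    using that by (auto simp: Y_equiv_iff[OF A \<M>])
  have "homeomorphic_map (quotient_topology ?T ?E) (top_of (Hu (reduct \<tau> A))) (\<Psi> A)"
  proof (rule homeomorphic_map_quotient_topology)
    show "compact_space ?T"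
      by (rule compact_Y_top[OF A \<M> fin])
    show "Hausdorff_space (top_of (Hu (reduct \<tau> A)))"
      by (simp add: top_Hu Hausdorff_space_subtopology Hausdorff_space_product_topology)
    show "continuous_map ?T (top_of (Hu (reduct \<tau> A))) (evaluation A)"
      using continuous_evaluation surj
      by (auto simp: top_Hu continuous_map_in_subtopology topspace_Y_top)
    show "evaluation A ` topspace ?T = topspace (top_of (Hu (reduct \<tau> A)))"
      by (simp add: topspace_Y_top topspace_Hu surj)
    show "\<Psi> A (?E `` {y}) = evaluation A y" if "y \<in> topspace ?T" for y
      using \<Psi>_Y_class[OF A \<M>] that by (simp add: topspace_Y_top)
    show "?E `` {y} = ?E `` {y'}"
      if "y \<in> topspace ?T" "y' \<in> topspace ?T" "evaluation A y = evaluation A y'" for y y'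
      using class_eq that unfolding topspace_Y_top by blast
  qed
  moreover have "(z, z') \<in> ord_of (Z_space ar \<M> \<Omega> A) \<longleftrightarrow> (\<Psi> A z, \<Psi> A z') \<in> ord_of (Hu (reduct \<tau> A))"
    if z: "z \<in> ?Y // ?E" "z' \<in> ?Y // ?E" for z z'
  proof -
    obtain y y' where y: "y \<in> ?Y" "z = ?E `` {y}" "y' \<in> ?Y" "z' = ?E `` {y'}"
      using z by (elim quotientE)
    have "(z, z') \<in> ord_of (Z_space ar \<M> \<Omega> A) \<longleftrightarrow> (y, y') \<in> Y_preord ar \<M> \<Omega> A"
    proof
      assume "(z, z') \<in> ord_of (Z_space ar \<M> \<Omega> A)"
      then obtain p p' where p: "z = ?E `` {p}" "z' = ?E `` {p'}" "(p, p') \<in> Y_preord ar \<M> \<Omega> A"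
        by (auto simp: Z_space_def)
      then have pY: "p \<in> ?Y" "p' \<in> ?Y"
        by (simp_all add: Y_preord_iff[OF A \<M>])
      then have "evaluation A p = evaluation A y" "evaluation A p' = evaluation A y'"
        using p y \<Psi>_Y_class[OF A \<M>] by metis+
      then show "(y, y') \<in> Y_preord ar \<M> \<Omega> A"
        using p y by (simp add: Y_preord_iff[OF A \<M>])
    next
      assume "(y, y') \<in> Y_preord ar \<M> \<Omega> A"
      then show "(z, z') \<in> ord_of (Z_space ar \<M> \<Omega> A)"
        unfolding Z_space_def using y by (simp del: split_paired_Ex) blast
    qed
    also have "\<dots> \<longleftrightarrow> (evaluation A y, evaluation A y') \<in> ord_of (Hu (reduct \<tau> A))"
      using y surj by (subst Hu_order) (auto simp: Y_preord_iff[OF A \<M>])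
    finally show ?thesis
      using y by (simp add: \<Psi>_Y_class[OF A \<M>])
  qed
  ultimately show ?thesis
    by (simp add: order_homeomorphism_def Z_space_def topspace_quotient_topology topspace_Y_top)
qed

theorem theorem6p2:
  fixes ar :: "'f \<Rightarrow> nat"
    and \<M> :: "('f, 'm) algebra set"
    and \<tau> :: "lat_op \<Rightarrow> 'f trm"
    and \<Omega> :: "('f, 'm) carriers"
    and G :: "('f, 'm) operations"
    and A :: "('f, 'a) algebra"
  assumes A1: "\<And>l. term_of_arity ar 2 (\<tau> l)"
      "\<And>B :: ('f, 'm) algebra. in_ISP TYPE('i) ar \<M> B \<Longrightarrow> distributive_lattice (reduct \<tau> B)"
    and A2: "sorts ar \<M>"
    and A3: "\<And>M. M \<in> \<M> \<Longrightarrow> \<Omega> M \<noteq> {} \<and> \<Omega> M \<subseteq> hom lat_ar (reduct \<tau> M) two"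
    and S1: "\<exists>M\<in>\<M>. \<exists>d. subuniverse ar M {d} \<and> (\<exists>\<omega>\<in>\<Omega> M. \<omega> d = True)"
    and S0: "\<exists>M\<in>\<M>. \<exists>d. subuniverse ar M {d} \<and> (\<exists>\<omega>\<in>\<Omega> M. \<omega> d = False)"
    and G: "\<And>M M'. M \<in> \<M> \<Longrightarrow> M' \<in> \<M> \<Longrightarrow> G M M' \<subseteq> hom ar M M'"
    and Sep: "Sep \<M> G \<Omega>"
    and A: "in_ISP TYPE('i) ar \<M> A"
  shows
    "(evaluation A respects Y_equiv ar \<M> \<Omega> A \<and>
      (\<forall>(x, \<omega>) \<in> Y_set ar \<M> \<Omega> A.
         \<Psi> A (Y_class ar \<M> \<Omega> A (x, \<omega>)) = compose (universe A) \<omega> x) \<and>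
      order_homeomorphism (Z_space ar \<M> \<Omega> A) (Hu (reduct \<tau> A)) (\<Psi> A)) \<and>
     (\<exists>(x\<^sub>1, \<omega>\<^sub>1) \<in> Y_set ar \<M> \<Omega> A. compose (universe A) \<omega>\<^sub>1 x\<^sub>1 = (\<lambda>a\<in>universe A. True)) \<and>
     (\<exists>(x\<^sub>0, \<omega>\<^sub>0) \<in> Y_set ar \<M> \<Omega> A. compose (universe A) \<omega>\<^sub>0 x\<^sub>0 = (\<lambda>a\<in>universe A. False)) \<and>
     (\<forall>(x\<^sub>1, \<omega>\<^sub>1) \<in> Y_set ar \<M> \<Omega> A. \<forall>(x\<^sub>0, \<omega>\<^sub>0) \<in> Y_set ar \<M> \<Omega> A.
        compose (universe A) \<omega>\<^sub>1 x\<^sub>1 = (\<lambda>a\<in>universe A. True) \<longrightarrow>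
        compose (universe A) \<omega>\<^sub>0 x\<^sub>0 = (\<lambda>a\<in>universe A. False) \<longrightarrow>
        (let Z = Z_pointed ar \<M> \<Omega> A
               (Y_class ar \<M> \<Omega> A (x\<^sub>1, \<omega>\<^sub>1)) (Y_class ar \<M> \<Omega> A (x\<^sub>0, \<omega>\<^sub>0))
         in pointed_priestley TYPE('a) Z \<and>
            pointed_priestley_isomorphism TYPE('a) Z (Hu (reduct \<tau> A)) (\<Psi> A)))"
proof -
  have alg: "is_algebra ar A"
    using A by (simp add: in_ISP_def)
  have L: "is_algebra lat_ar (reduct \<tau> A)"
    by (rule reduct_is_algebra[where \<tau> = \<tau>, OF alg A1(1)])
  have \<Omega>: "\<Omega> M \<subseteq> hom lat_ar (reduct \<tau> M) two" if "M \<in> \<M>" for M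
    using A3[OF that] by blast
  have fin: "finite (\<Omega> M)" if "M \<in> \<M>" for M
  proof (rule finite_subset)
    show "\<Omega> M \<subseteq> universe M \<rightarrow>\<^sub>E UNIV"
      using \<Omega>[OF that] hom_funcset by fastforce
    show "finite (universe M \<rightarrow>\<^sub>E (UNIV :: bool set))"
      using A2 that by (simp add: sorts_def finite_PiE)
  qed
  have const1: "(\<lambda>a\<in>universe A. True) \<in> evaluation A ` Y_set ar \<M> \<Omega> A"
    by (rule evaluation_constant[OF alg S1])
  have const0: "(\<lambda>a\<in>universe A. False) \<in> evaluation A ` Y_set ar \<M> \<Omega> A"
    by (rule evaluation_constant[OF alg S0])
  have surj: "evaluation A ` Y_set ar \<M> \<Omega> A = hom lat_ar (reduct \<tau> A) two"
    by (rule evaluation_surj[where \<tau> = \<tau>, OF A1(1) A2 \<Omega> fin G Sep A const1 const0])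
  have oh: "order_homeomorphism (Z_space ar \<M> \<Omega> A) (Hu (reduct \<tau> A)) (\<Psi> A)"
    by (rule order_homeomorphism_\<Psi>[OF alg A2 fin surj])
  have \<Psi>: "\<Psi> A (Y_class ar \<M> \<Omega> A (x, \<omega>)) = compose (universe A) \<omega> x"
    if "(x, \<omega>) \<in> Y_set ar \<M> \<Omega> A" for x \<omega>
    using \<Psi>_Y_class[OF alg A2 that] by (simp add: evaluation_def)
  have resp: "evaluation A respects Y_equiv ar \<M> \<Omega> A"
    by (auto simp: congruent_def Y_equiv_iff[OF alg A2])
  have pointed: "pointed_priestley TYPE('a) Z \<and>
      pointed_priestley_isomorphism TYPE('a) Z (Hu (reduct \<tau> A)) (\<Psi> A)"
    if y1: "y\<^sub>1 \<in> Y_set ar \<M> \<Omega> A" "evaluation A y\<^sub>1 = (\<lambda>a\<in>universe A. True)"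
      and y0: "y\<^sub>0 \<in> Y_set ar \<M> \<Omega> A" "evaluation A y\<^sub>0 = (\<lambda>a\<in>universe A. False)"
      and Z: "Z = Z_pointed ar \<M> \<Omega> A (Y_class ar \<M> \<Omega> A y\<^sub>1) (Y_class ar \<M> \<Omega> A y\<^sub>0)"
    for y\<^sub>1 y\<^sub>0 Z
  proof -
    have Z_simps: "top_of Z = top_of (Z_space ar \<M> \<Omega> A)" "ord_of Z = ord_of (Z_space ar \<M> \<Omega> A)"
        "pt1 Z = Y_class ar \<M> \<Omega> A y\<^sub>1" "pt0 Z = Y_class ar \<M> \<Omega> A y\<^sub>0"
      by (simp_all add: Z Z_pointed_def ordered_space.defs)
    have ohZ: "order_homeomorphism Z (Hu (reduct \<tau> A)) (\<Psi> A)"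
      using oh by (simp add: order_homeomorphism_def Z_simps)
    have "topspace (top_of Z) = Y_set ar \<M> \<Omega> A // Y_equiv ar \<M> \<Omega> A"
      by (simp add: Z_simps Z_space_def topspace_quotient_topology topspace_Y_top)
    then have psZ: "pointed_structure Z"
      using y1 y0 by (auto simp: pointed_structure_def Z_simps Z_space_def Y_preord_iff[OF alg A2]
          intro: quotientI)
    have "\<Psi> A (pt1 Z) = pt1 (Hu (reduct \<tau> A))" "\<Psi> A (pt0 Z) = pt0 (Hu (reduct \<tau> A))"
      using \<Psi>_Y_class[OF alg A2] y1 y0
      by (simp_all add: Z_simps Hu_def pointed_substructure_def two_power_def)
    then have iso: "pointed_isomorphism Z (Hu (reduct \<tau> A)) (\<Psi> A)"
      by (rule order_homeomorphism_imp_pointed_isomorphism[OF ohZ psZ pointed_structure_Hu[OF L]])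
    then show ?thesis
      using pointed_priestley_of_Hu_iso[OF L psZ iso]
        pointed_priestley_of_Hu_iso[OF L pointed_structure_Hu[OF L] pointed_isomorphism_id]
      by (simp add: pointed_priestley_isomorphism_def)
  qed
  have ev: "evaluation A (x, \<omega>) = compose (universe A) \<omega> x" for x :: "'a \<Rightarrow> 'm" and \<omega>
    by (simp add: evaluation_def)
  have one: "\<exists>(x\<^sub>1, \<omega>\<^sub>1) \<in> Y_set ar \<M> \<Omega> A. compose (universe A) \<omega>\<^sub>1 x\<^sub>1 = (\<lambda>a\<in>universe A. True)"
    using const1 by (force simp: evaluation_def)
  have zero: "\<exists>(x\<^sub>0, \<omega>\<^sub>0) \<in> Y_set ar \<M> \<Omega> A. compose (universe A) \<omega>\<^sub>0 x\<^sub>0 = (\<lambda>a\<in>universe A. False)"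
    using const0 by (force simp: evaluation_def)
  show ?thesis
    unfolding Let_def
    using resp \<Psi> oh one zero pointed[unfolded ev] by (auto simp: ev intro!: pointed)
qed

end
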